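(* Let $k$ be an algebraically closed field and let $Q,Q'$ be finite, connected, acyclic quivers. Let $\mathscr{Q}_{(Q,Q')}$ be the $2$-quiver induced by $(Q,Q')$. There exists an equivalence of categories $Rep_{(Q,Q')}\simeq Rep_k(\mathscr{Q}_{(Q,Q')})$ that restricts to an equivalence $rep_{(Q,Q')}\simeq rep_k(\mathscr{Q}_{(Q,Q')})$.
   Context: A quiver $Q=(Q_0,Q_1,s,t)$ has vertex set $Q_0$, arrow set $Q_1$, and source and target maps $s,t:Q_1\to Q_0$. $Rep_k(Q)$ is the category of $k$-linear representations $M=(M_i,\varphi_\alpha)_{i\in Q_0,\alpha\in Q_1}$ of $Q$ ($k$-vector spaces $M_i$ and $k$-linear maps $\varphi_\alpha:M_{s(\alpha)}\to M_{t(\alpha)}$); morphisms are families of linear maps $f_i$ commuting with the structure maps. $rep_k(Q)$ is the full subcategory of finite-dimensional representations. A birepresentation of $(Q,Q')$ is a triple $(V,V',\psi)$ with $V\in Rep_k(Q)$, $V'\in Rep_k(Q')$ and $\psi=(\psi^\alpha_\beta)$ a family of $k$-linear maps $\psi^\alpha_\beta:V_{t(\alpha)}\to V'_{s(\beta)}$, one for each pair $(\alpha,\beta)\in Q_1\times Q'_1$. A morphism $(V,V',\psi)\to (W,W',\theta)$ is a pair $(f,f')$ of morphisms $f:V\to W$ in $Rep_k(Q)$ and $f':V'\to W'$ in $Rep_k(Q')$ with $f'_{s(\beta)}\psi^\alpha_\beta=\theta^\alpha_\beta f_{t(\alpha)}$ for all $(\alpha,\beta)$. These form the category $Rep_{(Q,Q')}$;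 $rep_{(Q,Q')}$ is its full subcategory of finite-dimensional birepresentations (all vector spaces finite dimensional). The $2$-quiver $\mathscr{Q}_{(Q,Q')}$ induced by $(Q,Q')$ is the quiver with vertex set $Q_0\sqcup Q'_0$ and arrow set $Q_1\sqcup Q'_1\sqcup\{\varrho^\alpha_\beta:\alpha\in Q_1,\beta\in Q'_1\}$, where arrows of $Q$ and $Q'$ keep their sources and targets and $\varrho^\alpha_\beta$ is a new arrow from $t(\alpha)$ to $s(\beta)$, one for each pair $(\alpha,\beta)\in Q_1\times Q'_1$. *)

theory Defs
  imports
    "HOL-Algebra.Algebraic_Closure"
    "Graph_Theory.Graph_Theory"
    "Jordan_Normal_Form.Missing_VectorSpace"
begin

section \<open>Categories, functors and equivalences\<close>

text \<open>
  Arrows do not carry their source and target, so hom-sets of different pairs of objects may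
  overlap; composition and the arrow part of a functor take the objects as arguments.
  In \<open>cmp C x y z g f\<close>, \<open>f\<close> is an arrow from \<open>x\<close> to \<open>y\<close> and \<open>g\<close> one from \<open>y\<close> to \<open>z\<close>.
\<close>

record ('o, 'm) cat =
  Ob :: "'o set"
  Hom :: "'o \<Rightarrow> 'o \<Rightarrow> 'm set"
  idn :: "'o \<Rightarrow> 'm"
  cmp :: "'o \<Rightarrow> 'o \<Rightarrow> 'o \<Rightarrow> 'm \<Rightarrow> 'm \<Rightarrow> 'm"

locale category =
  fixes C :: "('o, 'm) cat"
  assumes idn_in_Hom: "x \<in> Ob C \<Longrightarrow> idn C x \<in> Hom C x x"
    and cmp_in_Hom: "\<lbrakk>x \<in> Ob C; y \<in> Ob C; z \<in> Ob C; f \<in> Hom C x y; g \<in> Hom C y z\<rbrakk>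
      \<Longrightarrow> cmp C x y z g f \<in> Hom C x z"
    and cmp_idn_right: "\<lbrakk>x \<in> Ob C; y \<in> Ob C; f \<in> Hom C x y\<rbrakk> \<Longrightarrow> cmp C x x y f (idn C x) = f"
    and cmp_idn_left: "\<lbrakk>x \<in> Ob C; y \<in> Ob C; f \<in> Hom C x y\<rbrakk> \<Longrightarrow> cmp C x y y (idn C y) f = f"
    and cmp_assoc: "\<lbrakk>w \<in> Ob C; x \<in> Ob C; y \<in> Ob C; z \<in> Ob C;
        f \<in> Hom C w x; g \<in> Hom C x y; h \<in> Hom C y z\<rbrakk>
      \<Longrightarrow> cmp C w x z (cmp C x y z h g) f = cmp C w y z h (cmp C w x y g f)"

definition full_subcategory :: "('o, 'm) cat \<Rightarrow> ('o \<Rightarrow> bool) \<Rightarrow> ('o, 'm) cat" where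
  "full_subcategory C P = C\<lparr>Ob := {x \<in> Ob C. P x}\<rparr>"

definition is_iso :: "('o, 'm) cat \<Rightarrow> 'o \<Rightarrow> 'o \<Rightarrow> 'm \<Rightarrow> bool" where
  "is_iso C x y f \<longleftrightarrow> f \<in> Hom C x y \<and>
     (\<exists>g \<in> Hom C y x. cmp C x y x g f = idn C x \<and> cmp C y x y f g = idn C y)"

record ('o, 'm, 'p, 'n) fctr =
  omap :: "'o \<Rightarrow> 'p"
  amap :: "'o \<Rightarrow> 'o \<Rightarrow> 'm \<Rightarrow> 'n"

locale cat_functor = C: category C + D: category D
  for C :: "('o, 'm) cat" and D :: "('p, 'n) cat" +
  fixes F :: "('o, 'm, 'p, 'n) fctr"
  assumes omap_in_Ob: "x \<in> Ob C \<Longrightarrow> omap F x \<in> Ob D"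
    and amap_in_Hom: "\<lbrakk>x \<in> Ob C; y \<in> Ob C; f \<in> Hom C x y\<rbrakk>
      \<Longrightarrow> amap F x y f \<in> Hom D (omap F x) (omap F y)"
    and amap_idn: "x \<in> Ob C \<Longrightarrow> amap F x x (idn C x) = idn D (omap F x)"
    and amap_cmp: "\<lbrakk>x \<in> Ob C; y \<in> Ob C; z \<in> Ob C; f \<in> Hom C x y; g \<in> Hom C y z\<rbrakk>
      \<Longrightarrow> amap F x z (cmp C x y z g f)
          = cmp D (omap F x) (omap F y) (omap F z) (amap F y z g) (amap F x y f)"

definition id_fctr :: "('o, 'm, 'o, 'm) fctr" where
  "id_fctr = \<lparr>omap = (\<lambda>x. x), amap = (\<lambda>x y f. f)\<rparr>"

definition comp_fctr ::
    "('p, 'n, 'q, 'r) fctr \<Rightarrow> ('o, 'm, 'p, 'n) fctr \<Rightarrow> ('o, 'm, 'q, 'r) fctr" where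
  "comp_fctr G F = \<lparr>omap = (\<lambda>x. omap G (omap F x)),
     amap = (\<lambda>x y f. amap G (omap F x) (omap F y) (amap F x y f))\<rparr>"

locale natural_iso = F: cat_functor C D F + G: cat_functor C D G
  for C :: "('o, 'm) cat" and D :: "('p, 'n) cat" and F G +
  fixes \<eta> :: "'o \<Rightarrow> 'n"
  assumes component_iso: "x \<in> Ob C \<Longrightarrow> is_iso D (omap F x) (omap G x) (\<eta> x)"
    and naturality: "\<lbrakk>x \<in> Ob C; y \<in> Ob C; f \<in> Hom C x y\<rbrakk>
      \<Longrightarrow> cmp D (omap F x) (omap F y) (omap G y) (\<eta> y) (amap F x y f)
          = cmp D (omap F x) (omap G x) (omap G y) (amap G x y f) (\<eta> x)"

definition is_equivalence ::
    "('o, 'm) cat \<Rightarrow> ('p, 'n) cat \<Rightarrow> ('o, 'm, 'p, 'n) fctr \<Rightarrow> bool" where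
  "is_equivalence C D F \<longleftrightarrow> cat_functor C D F \<and>
     (\<exists>G. cat_functor D C G \<and>
        (\<exists>\<eta>. natural_iso C C id_fctr (comp_fctr G F) \<eta>) \<and>
        (\<exists>\<epsilon>. natural_iso D D (comp_fctr F G) id_fctr \<epsilon>))"


section \<open>Representations of a quiver\<close>

text \<open>
  A quiver is a directed multigraph (\<^locale>\<open>wf_digraph\<close>); \<^const>\<open>tail\<close> is the source map and
  \<^const>\<open>head\<close> the target map. The \<open>K\<close>-vector spaces are all those whose underlying set is
  a subset of the type \<open>'v\<close>, which plays the role of the universe; the ring multiplication that
  a \<^type>\<open>module\<close> record also contains is ignored.
  Families and maps are extensional, i.e.\ \<^const>\<open>undefined\<close> outside their domain,
  so that equality of functions is equality of families and of maps.
\<close>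

definition linear_maps ::
    "'k ring \<Rightarrow> ('k, 'v) module \<Rightarrow> ('k, 'v) module \<Rightarrow> ('v \<Rightarrow> 'v) set" where
  "linear_maps K V W = module_hom K V W \<inter> extensional (carrier V)"

record ('i, 'a, 'k, 'v) rep =
  space :: "'i \<Rightarrow> ('k, 'v) module"
  strmap :: "'a \<Rightarrow> 'v \<Rightarrow> 'v"

definition representations ::
    "'k ring \<Rightarrow> ('i, 'a) pre_digraph \<Rightarrow> ('i, 'a, 'k, 'v) rep set" where
  "representations K Q = {M.
     space M \<in> extensional (verts Q) \<and>
     strmap M \<in> extensional (arcs Q) \<and>
     (\<forall>i \<in> verts Q. vectorspace K (space M i)) \<and>
     (\<forall>\<alpha> \<in> arcs Q. strmap M \<alpha> \<in> linear_maps K (space M (tail Q \<alpha>)) (space M (head Q \<alpha>)))}"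

definition rep_homs ::
    "'k ring \<Rightarrow> ('i, 'a) pre_digraph \<Rightarrow> ('i, 'a, 'k, 'v) rep \<Rightarrow> ('i, 'a, 'k, 'v) rep
      \<Rightarrow> ('i \<Rightarrow> 'v \<Rightarrow> 'v) set" where
  "rep_homs K Q M N = {f.
     f \<in> extensional (verts Q) \<and>
     (\<forall>i \<in> verts Q. f i \<in> linear_maps K (space M i) (space N i)) \<and>
     (\<forall>\<alpha> \<in> arcs Q.
        compose (carrier (space M (tail Q \<alpha>))) (f (head Q \<alpha>)) (strmap M \<alpha>)
        = compose (carrier (space M (tail Q \<alpha>))) (strmap N \<alpha>) (f (tail Q \<alpha>)))}"

definition rep_id ::
    "('i, 'a) pre_digraph \<Rightarrow> ('i, 'a, 'k, 'v) rep \<Rightarrow> 'i \<Rightarrow> 'v \<Rightarrow> 'v" where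
  "rep_id Q M = (\<lambda>i \<in> verts Q. \<lambda>x \<in> carrier (space M i). x)"

definition rep_comp ::
    "('i, 'a) pre_digraph \<Rightarrow> ('i, 'a, 'k, 'v) rep
      \<Rightarrow> ('i \<Rightarrow> 'v \<Rightarrow> 'v) \<Rightarrow> ('i \<Rightarrow> 'v \<Rightarrow> 'v) \<Rightarrow> 'i \<Rightarrow> 'v \<Rightarrow> 'v" where
  "rep_comp Q L g f = (\<lambda>i \<in> verts Q. compose (carrier (space L i)) (g i) (f i))"

definition Rep ::
    "'k ring \<Rightarrow> ('i, 'a) pre_digraph \<Rightarrow> (('i, 'a, 'k, 'v) rep, 'i \<Rightarrow> 'v \<Rightarrow> 'v) cat" where
  "Rep K Q = \<lparr>Ob = representations K Q, Hom = rep_homs K Q, idn = rep_id Q,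
     cmp = (\<lambda>L M N. rep_comp Q L)\<rparr>"

definition fin_dim_rep :: "'k ring \<Rightarrow> ('i, 'a) pre_digraph \<Rightarrow> ('i, 'a, 'k, 'v) rep \<Rightarrow> bool" where
  "fin_dim_rep K Q M \<longleftrightarrow> (\<forall>i \<in> verts Q. vectorspace.fin_dim K (space M i))"

definition rep_fd ::
    "'k ring \<Rightarrow> ('i, 'a) pre_digraph \<Rightarrow> (('i, 'a, 'k, 'v) rep, 'i \<Rightarrow> 'v \<Rightarrow> 'v) cat" where
  "rep_fd K Q = full_subcategory (Rep K Q) (fin_dim_rep K Q)"


section \<open>Birepresentations of a pair of quivers\<close>

record ('i, 'a, 'j, 'b, 'k, 'v) birep =
  lrep :: "('i, 'a, 'k, 'v) rep"
  rrep :: "('j, 'b, 'k, 'v) rep"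
  link :: "'a \<times> 'b \<Rightarrow> 'v \<Rightarrow> 'v"

definition birepresentations ::
    "'k ring \<Rightarrow> ('i, 'a) pre_digraph \<Rightarrow> ('j, 'b) pre_digraph
      \<Rightarrow> ('i, 'a, 'j, 'b, 'k, 'v) birep set" where
  "birepresentations K Q Q' = {B.
     lrep B \<in> representations K Q \<and>
     rrep B \<in> representations K Q' \<and>
     link B \<in> extensional (arcs Q \<times> arcs Q') \<and>
     (\<forall>\<alpha> \<in> arcs Q. \<forall>\<beta> \<in> arcs Q'.
        link B (\<alpha>, \<beta>)
          \<in> linear_maps K (space (lrep B) (head Q \<alpha>)) (space (rrep B) (tail Q' \<beta>)))}"

definition birep_homs ::
    "'k ring \<Rightarrow> ('i, 'a) pre_digraph \<Rightarrow> ('j, 'b) pre_digraph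
      \<Rightarrow> ('i, 'a, 'j, 'b, 'k, 'v) birep \<Rightarrow> ('i, 'a, 'j, 'b, 'k, 'v) birep
      \<Rightarrow> (('i \<Rightarrow> 'v \<Rightarrow> 'v) \<times> ('j \<Rightarrow> 'v \<Rightarrow> 'v)) set" where
  "birep_homs K Q Q' A B = {(f, f').
     f \<in> rep_homs K Q (lrep A) (lrep B) \<and>
     f' \<in> rep_homs K Q' (rrep A) (rrep B) \<and>
     (\<forall>\<alpha> \<in> arcs Q. \<forall>\<beta> \<in> arcs Q'.
        compose (carrier (space (lrep A) (head Q \<alpha>))) (f' (tail Q' \<beta>)) (link A (\<alpha>, \<beta>))
        = compose (carrier (space (lrep A) (head Q \<alpha>))) (link B (\<alpha>, \<beta>)) (f (head Q \<alpha>)))}"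

definition BiRep ::
    "'k ring \<Rightarrow> ('i, 'a) pre_digraph \<Rightarrow> ('j, 'b) pre_digraph
      \<Rightarrow> (('i, 'a, 'j, 'b, 'k, 'v) birep, ('i \<Rightarrow> 'v \<Rightarrow> 'v) \<times> ('j \<Rightarrow> 'v \<Rightarrow> 'v)) cat" where
  "BiRep K Q Q' = \<lparr>
     Ob = birepresentations K Q Q',
     Hom = birep_homs K Q Q',
     idn = (\<lambda>A. (rep_id Q (lrep A), rep_id Q' (rrep A))),
     cmp = (\<lambda>A B C (g, g') (f, f').
       (rep_comp Q (lrep A) g f, rep_comp Q' (rrep A) g' f'))\<rparr>"

definition birep_fd ::
    "'k ring \<Rightarrow> ('i, 'a) pre_digraph \<Rightarrow> ('j, 'b) pre_digraph
      \<Rightarrow> (('i, 'a, 'j, 'b, 'k, 'v) birep, ('i \<Rightarrow> 'v \<Rightarrow> 'v) \<times> ('j \<Rightarrow> 'v \<Rightarrow> 'v)) cat" where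
  "birep_fd K Q Q' = full_subcategory (BiRep K Q Q')
     (\<lambda>B. fin_dim_rep K Q (lrep B) \<and> fin_dim_rep K Q' (rrep B))"


section \<open>The induced 2-quiver\<close>

datatype ('a, 'b) arrow2 = LArr 'a | RArr 'b | Rho 'a 'b

primrec tail2 ::
    "('i, 'a) pre_digraph \<Rightarrow> ('j, 'b) pre_digraph \<Rightarrow> ('a, 'b) arrow2 \<Rightarrow> 'i + 'j" where
  "tail2 Q Q' (LArr \<alpha>) = Inl (tail Q \<alpha>)"
| "tail2 Q Q' (RArr \<beta>) = Inr (tail Q' \<beta>)"
| "tail2 Q Q' (Rho \<alpha> \<beta>) = Inl (head Q \<alpha>)"

primrec head2 ::
    "('i, 'a) pre_digraph \<Rightarrow> ('j, 'b) pre_digraph \<Rightarrow> ('a, 'b) arrow2 \<Rightarrow> 'i + 'j" where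
  "head2 Q Q' (LArr \<alpha>) = Inl (head Q \<alpha>)"
| "head2 Q Q' (RArr \<beta>) = Inr (head Q' \<beta>)"
| "head2 Q Q' (Rho \<alpha> \<beta>) = Inr (tail Q' \<beta>)"

definition two_quiver ::
    "('i, 'a) pre_digraph \<Rightarrow> ('j, 'b) pre_digraph \<Rightarrow> ('i + 'j, ('a, 'b) arrow2) pre_digraph" where
  "two_quiver Q Q' = \<lparr>
     verts = verts Q <+> verts Q',
     arcs = LArr ` arcs Q \<union> RArr ` arcs Q' \<union> {Rho \<alpha> \<beta> | \<alpha> \<beta>. \<alpha> \<in> arcs Q \<and> \<beta> \<in> arcs Q'},
     tail = tail2 Q Q',
     head = head2 Q Q'\<rparr>"

text \<open>A cycle in the sense of \<^const>\<open>pre_digraph.cycle\<close> is oriented, and loops are cycles.\<close>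

definition acyclic_quiver :: "('i, 'a) pre_digraph \<Rightarrow> bool" where
  "acyclic_quiver Q \<longleftrightarrow> (\<nexists>p. pre_digraph.cycle Q p)"

end

theory Submission
  imports Defs
begin

text \<open>
  A birepresentation \<open>(V, V', \<psi>)\<close> and a representation of the 2-quiver are the same data, arranged
  differently: the vertices of the 2-quiver carry the spaces of \<open>V\<close> and of \<open>V'\<close>, its old arrows
  carry the structure maps of \<open>V\<close> and of \<open>V'\<close>, and the new arrow from \<open>head Q \<alpha>\<close> to \<open>tail Q' \<beta>\<close>
  carries \<open>\<psi>\<close> at \<open>(\<alpha>, \<beta>)\<close>. A pair \<open>(f, f')\<close> is likewise the same as one family of maps indexed by the
  disjoint union of the vertex sets. For such a family, commuting with the structure maps of the
  2-quiver splits by the three kinds of arrows into: \<open>f\<close> is a morphism, \<open>f'\<close> is a morphism, and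
  the pair is compatible with \<open>\<psi>\<close>. Hence gluing is not merely an equivalence but an isomorphism
  of categories.

  Two parts carry the argument. An isomorphism of categories is an equivalence, with its inverse
  as quasi-inverse and identities as the components of both natural isomorphisms; and it restricts
  to the full subcategories of any two corresponding properties of objects. Gluing
  (\<open>cat_isomorphism_glue\<close>) is such an isomorphism, and by \<open>fin_dim_glue\<close> it matches
  finite-dimensional objects with finite-dimensional objects, because gluing changes no space.
  One functor therefore serves for both equivalences.
\<close>

section \<open>Isomorphisms of categories\<close>

lemma category_full_subcategory:
  assumes "category C"
  shows "category (full_subcategory C P)"
proof -
  interpret category C by fact
  show ?thesis
    by unfold_locales
      (simp_all add: full_subcategory_def idn_in_Hom cmp_in_Hom cmp_idn_right cmp_idn_left cmp_assoc)
qed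

text \<open>
  Functors are compared only on the objects and arrows of \<open>E\<close>, since their values elsewhere are
  arbitrary. The identities are the components of the natural isomorphism.
\<close>

lemma natural_iso_if_functors_agree:
  assumes E: "cat_functor E E H" "cat_functor E E H'"
    and "\<And>x. x \<in> Ob E \<Longrightarrow> omap H x = omap H' x"
    and "\<And>x y f. \<lbrakk>x \<in> Ob E; y \<in> Ob E; f \<in> Hom E x y\<rbrakk> \<Longrightarrow> amap H x y f = amap H' x y f"
  shows "\<exists>\<eta>. natural_iso E E H H' \<eta>"
proof -
  interpret H: cat_functor E E H by fact
  interpret H': cat_functor E E H' by fact
  have "natural_iso E E H H' (\<lambda>x. idn E (omap H x))"
  proof
    fix x assume "x \<in> Ob E"
    then show "is_iso E (omap H x) (omap H' x) (idn E (omap H x))"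
      using assms by (auto simp: is_iso_def H.C.idn_in_Hom H.C.cmp_idn_left H'.omap_in_Ob
          intro!: bexI[of _ "idn E (omap H x)"])
  next
    fix x y f assume "x \<in> Ob E" "y \<in> Ob E" "f \<in> Hom E x y"
    then show "cmp E (omap H x) (omap H y) (omap H' y) (idn E (omap H y)) (amap H x y f)
        = cmp E (omap H x) (omap H' x) (omap H' y) (amap H' x y f) (idn E (omap H x))"
      using assms H'.amap_in_Hom[of x y f]
      by (simp add: H.C.cmp_idn_left H.C.cmp_idn_right H'.omap_in_Ob)
  qed
  then show ?thesis by blast
qed

text \<open>
  The source is only assumed to have identities and composites in the right hom-sets. Its unit and
  associativity laws can be pulled back from the target, because a functor that is injective on
  arrows reflects equations; so they need to be verified only for representations of quivers and
  not again for birepresentations.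
\<close>

locale cat_isomorphism = D: category D
  for C :: "('o, 'm) cat" and D :: "('p, 'n) cat" and F :: "('o, 'm, 'p, 'n) fctr" +
  assumes bij_omap: "bij_betw (omap F) (Ob C) (Ob D)"
    and bij_amap: "\<lbrakk>x \<in> Ob C; y \<in> Ob C\<rbrakk>
      \<Longrightarrow> bij_betw (amap F x y) (Hom C x y) (Hom D (omap F x) (omap F y))"
    and idn_in_Hom: "x \<in> Ob C \<Longrightarrow> idn C x \<in> Hom C x x"
    and cmp_in_Hom: "\<lbrakk>x \<in> Ob C; y \<in> Ob C; z \<in> Ob C; f \<in> Hom C x y; g \<in> Hom C y z\<rbrakk>
      \<Longrightarrow> cmp C x y z g f \<in> Hom C x z"
    and amap_idn: "x \<in> Ob C \<Longrightarrow> amap F x x (idn C x) = idn D (omap F x)"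
    and amap_cmp: "\<lbrakk>x \<in> Ob C; y \<in> Ob C; z \<in> Ob C; f \<in> Hom C x y; g \<in> Hom C y z\<rbrakk>
      \<Longrightarrow> amap F x z (cmp C x y z g f)
          = cmp D (omap F x) (omap F y) (omap F z) (amap F y z g) (amap F x y f)"
begin

lemma omap_in_Ob [simp]: "x \<in> Ob C \<Longrightarrow> omap F x \<in> Ob D"
  using bij_omap by (auto dest: bij_betwE)

lemma amap_in_Hom [simp]: "\<lbrakk>x \<in> Ob C; y \<in> Ob C; f \<in> Hom C x y\<rbrakk>
    \<Longrightarrow> amap F x y f \<in> Hom D (omap F x) (omap F y)"
  using bij_amap by (auto dest: bij_betwE)

lemma amap_eqD:
  "\<lbrakk>amap F x y f = amap F x y g; x \<in> Ob C; y \<in> Ob C; f \<in> Hom C x y; g \<in> Hom C x y\<rbrakk> \<Longrightarrow> f = g"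
  using bij_amap by (metis bij_betw_imp_inj_on inj_onD)

lemma category_source: "category C"
proof
  fix x y f assume "x \<in> Ob C" "y \<in> Ob C" "f \<in> Hom C x y"
  then show "cmp C x x y f (idn C x) = f" "cmp C x y y (idn C y) f = f"
    by (auto intro!: amap_eqD[where x = x and y = y] idn_in_Hom cmp_in_Hom
        simp: amap_cmp amap_idn idn_in_Hom D.cmp_idn_right D.cmp_idn_left)
next
  fix w x y z f g h
  assume *: "w \<in> Ob C" "x \<in> Ob C" "y \<in> Ob C" "z \<in> Ob C"
    "f \<in> Hom C w x" "g \<in> Hom C x y" "h \<in> Hom C y z"
  then have "cmp C w x y g f \<in> Hom C w y" "cmp C x y z h g \<in> Hom C x z"
    by (auto intro: cmp_in_Hom)
  with * show "cmp C w x z (cmp C x y z h g) f = cmp C w y z h (cmp C w x y g f)"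
    by (intro amap_eqD[where x = w and y = z])
      (auto simp: amap_cmp D.cmp_assoc intro: cmp_in_Hom)
qed (auto intro: idn_in_Hom cmp_in_Hom)

sublocale C: category C
  by (rule category_source)

sublocale cat_functor C D F
  by unfold_locales (auto simp: amap_idn amap_cmp)

definition inverse_functor :: "('p, 'n, 'o, 'm) fctr" where
  "inverse_functor = (let G = inv_into (Ob C) (omap F) in
     \<lparr>omap = G, amap = (\<lambda>u v. inv_into (Hom C (G u) (G v)) (amap F (G u) (G v)))\<rparr>)"

lemma inverse_omap [simp]:
  "x \<in> Ob C \<Longrightarrow> omap inverse_functor (omap F x) = x"
  "u \<in> Ob D \<Longrightarrow> omap F (omap inverse_functor u) = u"
  "u \<in> Ob D \<Longrightarrow> omap inverse_functor u \<in> Ob C"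
  using bij_betw_inv_into_left[OF bij_omap] bij_betw_inv_into_right[OF bij_omap]
    bij_betwE[OF bij_betw_inv_into[OF bij_omap]]
  by (auto simp: inverse_functor_def Let_def)

lemma inverse_amap_left [simp]:
  assumes "x \<in> Ob C" "y \<in> Ob C" "f \<in> Hom C x y"
  shows "amap inverse_functor (omap F x) (omap F y) (amap F x y f) = f"
proof -
  have "inv_into (Ob C) (omap F) (omap F x) = x" "inv_into (Ob C) (omap F) (omap F y) = y"
    using assms bij_betw_inv_into_left[OF bij_omap] by auto
  then show ?thesis
    using assms bij_betw_inv_into_left[OF bij_amap] by (simp add: inverse_functor_def Let_def)
qed

text \<open>
  Every arrow of the target, together with its end points, is an image. Statements about the inverse
  functor thereby reduce to arrows of the source, where the inverse cancels.
\<close>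

lemma target_arrow_cases:
  assumes "u \<in> Ob D" "v \<in> Ob D" "h \<in> Hom D u v"
  obtains x y f where "x \<in> Ob C" "y \<in> Ob C" "f \<in> Hom C x y"
    "u = omap F x" "v = omap F y" "h = amap F x y f"
proof -
  obtain x y where xy: "x \<in> Ob C" "y \<in> Ob C" "u = omap F x" "v = omap F y"
    using assms bij_omap by (metis bij_betw_imp_surj_on imageE)
  moreover obtain f where "f \<in> Hom C x y" "h = amap F x y f"
    using bij_amap xy assms by (metis bij_betw_imp_surj_on imageE)
  ultimately show thesis using that by blast
qed

lemma inverse_amap_right [simp]:
  assumes "u \<in> Ob D" "v \<in> Ob D" "h \<in> Hom D u v"
  shows "amap F (omap inverse_functor u) (omap inverse_functor v) (amap inverse_functor u v h) = h"
  using assms by (rule target_arrow_cases) auto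

lemma functor_inverse: "cat_functor D C inverse_functor"
proof
  fix u v h assume "u \<in> Ob D" "v \<in> Ob D" "h \<in> Hom D u v"
  then show "amap inverse_functor u v h
      \<in> Hom C (omap inverse_functor u) (omap inverse_functor v)"
    by (rule target_arrow_cases) auto
next
  fix u assume "u \<in> Ob D"
  then show "amap inverse_functor u u (idn D u) = idn C (omap inverse_functor u)"
    by (metis inverse_omap(2,3) amap_idn inverse_amap_left idn_in_Hom)
next
  fix u v w h k
  assume D: "u \<in> Ob D" "v \<in> Ob D" "w \<in> Ob D" "h \<in> Hom D u v" "k \<in> Hom D v w"
  obtain x y f where f: "x \<in> Ob C" "y \<in> Ob C" "f \<in> Hom C x y"
    "u = omap F x" "v = omap F y" "h = amap F x y f"
    using D by (blast elim: target_arrow_cases)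
  obtain y' z g where g: "y' \<in> Ob C" "z \<in> Ob C" "g \<in> Hom C y' z"
    "v = omap F y'" "w = omap F z" "k = amap F y' z g"
    using D by (blast elim: target_arrow_cases)
  have "y' = y" using f g by (metis inverse_omap(1))
  with f g have "cmp D u v w k h = amap F x z (cmp C x y z g f)"
    by (simp add: amap_cmp)
  moreover have "cmp C x y z g f \<in> Hom C x z"
    using f g \<open>y' = y\<close> by (auto intro: cmp_in_Hom)
  ultimately show "amap inverse_functor u w (cmp D u v w k h)
      = cmp C (omap inverse_functor u) (omap inverse_functor v) (omap inverse_functor w)
          (amap inverse_functor v w k) (amap inverse_functor u v h)"
    using f g \<open>y' = y\<close> by simp
qed simp

text \<open>
  Both composites with the inverse functor agree with the identity functor on objects and arrows.
\<close>

lemma equivalence: "is_equivalence C D F"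
proof -
  interpret G: cat_functor D C inverse_functor by (rule functor_inverse)
  have "cat_functor C C id_fctr" "cat_functor D D id_fctr"
    by (unfold_locales; simp add: id_fctr_def)+
  moreover have "cat_functor C C (comp_fctr inverse_functor F)"
    by unfold_locales
      (simp_all add: comp_fctr_def idn_in_Hom cmp_in_Hom)
  moreover have "cat_functor D D (comp_fctr F inverse_functor)"
    by unfold_locales
      (simp_all add: comp_fctr_def G.amap_in_Hom G.amap_idn G.amap_cmp amap_idn amap_cmp)
  ultimately have
    "\<exists>\<eta>. natural_iso C C id_fctr (comp_fctr inverse_functor F) \<eta>"
    "\<exists>\<epsilon>. natural_iso D D (comp_fctr F inverse_functor) id_fctr \<epsilon>"
    by - (rule natural_iso_if_functors_agree; simp add: id_fctr_def comp_fctr_def)+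
  then show ?thesis
    unfolding is_equivalence_def
    using cat_functor_axioms functor_inverse by blast
qed

lemma restrict_full_subcategory:
  assumes "\<And>x. x \<in> Ob C \<Longrightarrow> P' (omap F x) \<longleftrightarrow> P x"
  shows "cat_isomorphism (full_subcategory C P) (full_subcategory D P') F"
proof -
  interpret D': category "full_subcategory D P'"
    by (rule category_full_subcategory) unfold_locales
  have "bij_betw (omap F) {x \<in> Ob C. P x} {u \<in> Ob D. P' u}"
    by (rule bij_betw_subset[OF bij_omap])
      (auto simp: assms simp flip: bij_betw_imp_surj_on[OF bij_omap])
  then show ?thesis
    by unfold_locales (auto simp: full_subcategory_def bij_amap idn_in_Hom cmp_in_Hom amap_idn amap_cmp)
qed

end

section \<open>The category of representations of a quiver\<close>

lemma linear_mapsD: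
  assumes "f \<in> linear_maps K V W"
  shows "x \<in> carrier V \<Longrightarrow> f x \<in> carrier W"
  using assms by (auto simp: linear_maps_def module_hom_def)

lemma linear_maps_id: "(\<lambda>x\<in>carrier V. x) \<in> linear_maps K V V" if "vectorspace K V"
proof -
  interpret vectorspace K V by fact
  show ?thesis by (auto simp: linear_maps_def module_hom_def)
qed

lemma linear_maps_compose:
  assumes "vectorspace K V" "f \<in> linear_maps K V W" "g \<in> linear_maps K W U"
  shows "compose (carrier V) g f \<in> linear_maps K V U"
proof -
  interpret vectorspace K V by fact
  show ?thesis using assms(2,3)
    by (auto simp: linear_maps_def module_hom_def compose_def Pi_iff)
qed

lemma rep_homs_commute:
  assumes "f \<in> rep_homs K Q M N" "\<alpha> \<in> arcs Q" "x \<in> carrier (space M (tail Q \<alpha>))"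
  shows "f (head Q \<alpha>) (strmap M \<alpha> x) = strmap N \<alpha> (f (tail Q \<alpha>) x)"
  using assms by (auto simp: rep_homs_def compose_def fun_eq_iff restrict_def split: if_splits)

lemma category_Rep:
  assumes "wf_digraph Q"
  shows "category (Rep K Q)"
proof -
  interpret wf_digraph Q by fact
  have space: "vectorspace K (space M i)" if "M \<in> representations K Q" "i \<in> verts Q" for M i
    using that by (auto simp: representations_def)
  have strmap: "strmap M \<alpha> \<in> linear_maps K (space M (tail Q \<alpha>)) (space M (head Q \<alpha>))"
    if "M \<in> representations K Q" "\<alpha> \<in> arcs Q" for M \<alpha>
    using that by (auto simp: representations_def)
  have hom: "f \<in> extensional (verts Q)"
      "i \<in> verts Q \<Longrightarrow> f i \<in> linear_maps K (space M i) (space N i)"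
    if "f \<in> rep_homs K Q M N" for f M N i
    using that by (auto simp: rep_homs_def)
  have idn: "rep_id Q M \<in> rep_homs K Q M M" if M: "M \<in> representations K Q" for M
    using linear_mapsD[OF strmap[OF M]]
    by (auto simp: rep_homs_def rep_id_def linear_maps_id space[OF M] compose_def fun_eq_iff)
  have cmp: "rep_comp Q L g f \<in> rep_homs K Q L N"
    if L: "L \<in> representations K Q"
      and f: "f \<in> rep_homs K Q L M" and g: "g \<in> rep_homs K Q M N" for L M N f g
  proof -
    have "compose (carrier (space L (tail Q \<alpha>))) (rep_comp Q L g f (head Q \<alpha>)) (strmap L \<alpha>)
        = compose (carrier (space L (tail Q \<alpha>))) (strmap N \<alpha>) (rep_comp Q L g f (tail Q \<alpha>))"
      if "\<alpha> \<in> arcs Q" for \<alpha>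
      using that rep_homs_commute[OF f that] rep_homs_commute[OF g that]
        linear_mapsD[OF strmap[OF L that]] linear_mapsD[OF hom(2)[OF f]]
      by (auto simp: rep_comp_def compose_def fun_eq_iff)
    then show ?thesis
      using linear_maps_compose[OF space[OF L] hom(2)[OF f] hom(2)[OF g]]
      by (auto simp: rep_homs_def rep_comp_def)
  qed
  show ?thesis
  proof
    fix M N f assume "M \<in> Ob (Rep K Q)" "N \<in> Ob (Rep K Q)" and "f \<in> Hom (Rep K Q) M N"
    then have f: "f \<in> rep_homs K Q M N" by (simp add: Rep_def)
    show "cmp (Rep K Q) M M N f (idn (Rep K Q) M) = f"
      using hom[OF f]
      by (auto simp: Rep_def rep_comp_def rep_id_def compose_def fun_eq_iff extensional_def
          linear_maps_def restrict_def)
    show "cmp (Rep K Q) M N N (idn (Rep K Q) N) f = f"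
      using hom[OF f] linear_mapsD[OF hom(2)[OF f]]
      by (auto simp: Rep_def rep_comp_def rep_id_def compose_def fun_eq_iff extensional_def
          linear_maps_def restrict_def)
  next
    fix L M N P f g h
    assume "f \<in> Hom (Rep K Q) L M"
    then have "f \<in> rep_homs K Q L M" by (simp add: Rep_def)
    then show "cmp (Rep K Q) L M P (cmp (Rep K Q) M N P h g) f
        = cmp (Rep K Q) L N P h (cmp (Rep K Q) L M N g f)"
      using linear_mapsD[OF hom(2)]
      by (fastforce simp: Rep_def rep_comp_def compose_def fun_eq_iff restrict_def)
  qed (simp_all add: Rep_def idn cmp)
qed

section \<open>Gluing a birepresentation to a representation of the 2-quiver\<close>

lemma two_quiver_simps [simp]:
  "verts (two_quiver Q Q') = verts Q <+> verts Q'"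
  "tail (two_quiver Q Q') = tail2 Q Q'"
  "head (two_quiver Q Q') = head2 Q Q'"
  by (simp_all add: two_quiver_def)

lemma arcs_two_quiver [simp]:
  "LArr \<alpha> \<in> arcs (two_quiver Q Q') \<longleftrightarrow> \<alpha> \<in> arcs Q"
  "RArr \<beta> \<in> arcs (two_quiver Q Q') \<longleftrightarrow> \<beta> \<in> arcs Q'"
  "Rho \<alpha> \<beta> \<in> arcs (two_quiver Q Q') \<longleftrightarrow> \<alpha> \<in> arcs Q \<and> \<beta> \<in> arcs Q'"
  by (auto simp: two_quiver_def)

lemma all_arrow2: "(\<forall>a. P a) \<longleftrightarrow> (\<forall>\<alpha>. P (LArr \<alpha>)) \<and> (\<forall>\<beta>. P (RArr \<beta>)) \<and> (\<forall>\<alpha> \<beta>. P (Rho \<alpha> \<beta>))"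
  by (metis arrow2.exhaust)

lemma wf_digraph_two_quiver:
  assumes "wf_digraph Q" "wf_digraph Q'"
  shows "wf_digraph (two_quiver Q Q')"
proof -
  interpret Q: wf_digraph Q by fact
  interpret Q': wf_digraph Q' by fact
  show ?thesis
  proof
    fix a assume "a \<in> arcs (two_quiver Q Q')"
    then have "tail2 Q Q' a \<in> verts Q <+> verts Q' \<and> head2 Q Q' a \<in> verts Q <+> verts Q'"
      by (cases a) auto
    then show "tail (two_quiver Q Q') a \<in> verts (two_quiver Q Q')"
      "head (two_quiver Q Q') a \<in> verts (two_quiver Q Q')"
      by simp_all
  qed
qed

text \<open>
  Since the components of a birepresentation are already \<^const>\<open>undefined\<close> off their domains, the
  glued families are extensional without being restricted to the 2-quiver. Unrestricted, gluing is a
  bijection between whole record types, whose inverse is \<open>unglue\<close>.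
\<close>

definition glue ::
    "('i, 'a, 'j, 'b, 'k, 'v) birep \<Rightarrow> ('i + 'j, ('a, 'b) arrow2, 'k, 'v) rep" where
  "glue B = \<lparr>space = case_sum (space (lrep B)) (space (rrep B)),
     strmap = case_arrow2 (strmap (lrep B)) (strmap (rrep B)) (\<lambda>\<alpha> \<beta>. link B (\<alpha>, \<beta>))\<rparr>"

definition unglue ::
    "('i + 'j, ('a, 'b) arrow2, 'k, 'v) rep \<Rightarrow> ('i, 'a, 'j, 'b, 'k, 'v) birep" where
  "unglue M = \<lparr>lrep = \<lparr>space = space M \<circ> Inl, strmap = strmap M \<circ> LArr\<rparr>,
     rrep = \<lparr>space = space M \<circ> Inr, strmap = strmap M \<circ> RArr\<rparr>,
     link = (\<lambda>(\<alpha>, \<beta>). strmap M (Rho \<alpha> \<beta>))\<rparr>"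

lemma glue_simps [simp]:
  "space (glue B) (Inl i) = space (lrep B) i"
  "space (glue B) (Inr j) = space (rrep B) j"
  "strmap (glue B) (LArr \<alpha>) = strmap (lrep B) \<alpha>"
  "strmap (glue B) (RArr \<beta>) = strmap (rrep B) \<beta>"
  "strmap (glue B) (Rho \<alpha> \<beta>) = link B (\<alpha>, \<beta>)"
  by (simp_all add: glue_def)

lemma unglue_glue: "unglue (glue B) = B"
  by (auto simp: unglue_def intro!: birep.equality rep.equality)

lemma glue_unglue: "glue (unglue M) = M"
  by (auto simp: glue_def unglue_def fun_eq_iff split: sum.split arrow2.split intro!: rep.equality)

text \<open>
  One direction makes gluing land in the representations, the other makes it hit all of them.
  Extensionality is preserved both ways because the vertices and arrows of the 2-quiver are tagged
  disjoint unions.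
\<close>

lemma glue_in_representations:
  "glue B \<in> representations K (two_quiver Q Q') \<longleftrightarrow> B \<in> birepresentations K Q Q'"
  by (auto simp: representations_def birepresentations_def extensional_def Ball_def all_arrow2
      split_sum_all)

text \<open>
  The commutation condition over the arrows of the 2-quiver splits, by the kind of arrow, into the
  three conditions that define a morphism of birepresentations: the new arrows give exactly the
  compatibility with the links.
\<close>

lemma case_sum_in_rep_homs:
  "case_sum f f' \<in> rep_homs K (two_quiver Q Q') (glue A) (glue B)
    \<longleftrightarrow> (f, f') \<in> birep_homs K Q Q' A B"
  by (auto simp: rep_homs_def birep_homs_def extensional_def Ball_def all_arrow2 split_sum_all)

lemma case_sum_rep_id:
  "case_sum (rep_id Q (lrep A)) (rep_id Q' (rrep A)) = rep_id (two_quiver Q Q') (glue A)"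
  by (auto simp: rep_id_def fun_eq_iff restrict_def split: sum.split)

lemma case_sum_rep_comp:
  "case_sum (rep_comp Q (lrep A) g f) (rep_comp Q' (rrep A) g' f')
    = rep_comp (two_quiver Q Q') (glue A) (case_sum g g') (case_sum f f')"
  by (auto simp: rep_comp_def fun_eq_iff restrict_def split: sum.split)

definition glue_functor ::
    "(('i, 'a, 'j, 'b, 'k, 'v) birep, ('i \<Rightarrow> 'v \<Rightarrow> 'v) \<times> ('j \<Rightarrow> 'v \<Rightarrow> 'v),
      ('i + 'j, ('a, 'b) arrow2, 'k, 'v) rep, 'i + 'j \<Rightarrow> 'v \<Rightarrow> 'v) fctr" where
  "glue_functor = \<lparr>omap = glue, amap = (\<lambda>A B (f, f'). case_sum f f')\<rparr>"

lemma cat_isomorphism_glue: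
  assumes "wf_digraph Q" "wf_digraph Q'"
  shows "cat_isomorphism (BiRep K Q Q') (Rep K (two_quiver Q Q')) glue_functor"
proof -
  interpret D: category "Rep K (two_quiver Q Q')"
    by (intro category_Rep wf_digraph_two_quiver assms)
  have hom: "case_sum f f' \<in> Hom (Rep K (two_quiver Q Q')) (glue A) (glue B)
      \<longleftrightarrow> (f, f') \<in> Hom (BiRep K Q Q') A B" for f f' A B
    by (simp add: Rep_def BiRep_def case_sum_in_rep_homs)
  have ob: "glue B \<in> Ob (Rep K (two_quiver Q Q')) \<longleftrightarrow> B \<in> Ob (BiRep K Q Q')" for B
    by (simp add: Rep_def BiRep_def glue_in_representations)
  show ?thesis
  proof
    show "bij_betw (omap glue_functor) (Ob (BiRep K Q Q')) (Ob (Rep K (two_quiver Q Q')))"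
      by (rule bij_betw_byWitness[where f' = unglue])
        (auto simp: glue_functor_def unglue_glue glue_unglue ob simp flip: ob)
  next
    fix A B
    show "bij_betw (amap glue_functor A B) (Hom (BiRep K Q Q') A B)
        (Hom (Rep K (two_quiver Q Q')) (omap glue_functor A) (omap glue_functor B))"
      by (rule bij_betw_byWitness[where f' = "\<lambda>h. (h \<circ> Inl, h \<circ> Inr)"])
        (auto simp: glue_functor_def hom surjective_sum comp_def simp flip: hom)
  next
    fix A assume "A \<in> Ob (BiRep K Q Q')"
    then have "rep_id (two_quiver Q Q') (glue A) \<in> Hom (Rep K (two_quiver Q Q')) (glue A) (glue A)"
      using D.idn_in_Hom[of "glue A"] ob by (auto simp: Rep_def)
    then show "idn (BiRep K Q Q') A \<in> Hom (BiRep K Q Q') A A"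
      unfolding case_sum_rep_id[symmetric] hom by (simp add: BiRep_def)
  next
    fix A show "amap glue_functor A A (idn (BiRep K Q Q') A)
        = idn (Rep K (two_quiver Q Q')) (omap glue_functor A)"
      by (simp add: glue_functor_def BiRep_def Rep_def case_sum_rep_id)
  next
    fix A B C f g
    show "amap glue_functor A C (cmp (BiRep K Q Q') A B C g f)
        = cmp (Rep K (two_quiver Q Q')) (omap glue_functor A) (omap glue_functor B)
            (omap glue_functor C) (amap glue_functor B C g) (amap glue_functor A B f)"
      by (simp add: glue_functor_def BiRep_def Rep_def case_sum_rep_comp split: prod.split)
  next
    fix A B C f g
    assume "A \<in> Ob (BiRep K Q Q')" "B \<in> Ob (BiRep K Q Q')" "C \<in> Ob (BiRep K Q Q')"
      "f \<in> Hom (BiRep K Q Q') A B" "g \<in> Hom (BiRep K Q Q') B C"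
    then show "cmp (BiRep K Q Q') A B C g f \<in> Hom (BiRep K Q Q') A C"
      using D.cmp_in_Hom[of "glue A" "glue B" "glue C"]
      by (cases f; cases g)
        (auto simp: BiRep_def Rep_def case_sum_rep_comp glue_in_representations
          simp flip: case_sum_in_rep_homs)
  qed
qed

lemma fin_dim_glue:
  "fin_dim_rep K (two_quiver Q Q') (glue B)
    \<longleftrightarrow> fin_dim_rep K Q (lrep B) \<and> fin_dim_rep K Q' (rrep B)"
  by (auto simp: fin_dim_rep_def Ball_def split_sum_all)

theorem proposition5p4:
  fixes K :: "'k ring"
    and Q :: "('i, 'a) pre_digraph"
    and Q' :: "('j, 'b) pre_digraph"
  assumes "algebraically_closed K"
    and "fin_digraph Q" and "Digraph_Component.connected Q" and "acyclic_quiver Q"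
    and "fin_digraph Q'" and "Digraph_Component.connected Q'" and "acyclic_quiver Q'"
  shows "\<exists>F :: (('i, 'a, 'j, 'b, 'k, 'v) birep, ('i \<Rightarrow> 'v \<Rightarrow> 'v) \<times> ('j \<Rightarrow> 'v \<Rightarrow> 'v),
               ('i + 'j, ('a, 'b) arrow2, 'k, 'v) rep, 'i + 'j \<Rightarrow> 'v \<Rightarrow> 'v) fctr.
           is_equivalence (BiRep K Q Q') (Rep K (two_quiver Q Q')) F \<and>
           is_equivalence (birep_fd K Q Q') (rep_fd K (two_quiver Q Q')) F"
proof -
  have iso: "cat_isomorphism (BiRep K Q Q') (Rep K (two_quiver Q Q')) glue_functor"
    using assms(2,5) by (intro cat_isomorphism_glue) (rule fin_digraph.axioms(1), assumption)+
  have "cat_isomorphism (birep_fd K Q Q') (rep_fd K (two_quiver Q Q')) glue_functor"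
    unfolding birep_fd_def rep_fd_def
    by (rule cat_isomorphism.restrict_full_subcategory[OF iso])
      (simp add: glue_functor_def fin_dim_glue)
  with iso show ?thesis
    by (intro exI[of _ glue_functor] conjI cat_isomorphism.equivalence)
qed

end
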